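(* Let $n\le 3$ and let $A=[\xi_{ij}]_{n\times n}\in\mathbb{C}_2^{n\times n}$ be a non-singular bicomplex matrix such that $\xi_{ij}\notin O_2$ for all $i,j$. Then $\rho(A)=n$.
   Context: $\mathbb{C}_1$ denotes the complex numbers (imaginary unit $i_1$). $\mathbb{C}_2=\{z_1+i_2z_2: z_1,z_2\in\mathbb{C}_1\}$ is the commutative ring of bicomplex numbers, where $i_1i_2=i_2i_1$, $i_1^2=i_2^2=-1$. Put $e_1=\frac{1+i_1i_2}{2}$, $e_2=\frac{1-i_1i_2}{2}$; every $\xi\in\mathbb{C}_2$ is uniquely $\xi=1_\xi e_1+2_\xi e_2$ with $1_\xi,2_\xi\in\mathbb{C}_1$, and operations are component-wise in this representation. $O_2$ is the set of non-invertible elements of $\mathbb{C}_2$ (including $0$). A square bicomplex matrix $B$ is non-singular if $\det(B)\notin O_2$. Rank: write $B\preccurlyeq C$ if $B$ is a sub-matrix of $C$ (obtained by omitting some, possibly no, rows and columns). For $A\in\mathbb{C}_2^{n\times m}$, $\rho(A)$ is the number $r\ge 1$ such that (i) there is a chain $B_1\preccurlyeq B_2\preccurlyeq\cdots\preccurlyeq B_r\preccurlyeq A$ in which each $B_i$ is a non-singular $i\times i$ sub-matrix; and (ii) no such chain $B_1\preccurlyeq\cdots\preccurlyeq B_t=B'$ exists for any $t\times t$ sub-matrix $B'$ of $A$ with $t>r$. If no such $r$ exists, $\rho(A)=0$. *)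

theory Defs
  imports Complex_Main
    "Jordan_Normal_Form.Determinant"
    "Jordan_Normal_Form.DL_Submatrix"
begin

text \<open>\<open>Bicomplex z\<^sub>1 z\<^sub>2\<close> stands for \<open>z\<^sub>1 + i\<^sub>2 z\<^sub>2\<close>;
  the unit \<open>i\<^sub>1\<close> is the imaginary unit of type \<^typ>\<open>complex\<close>.\<close>

datatype bicomplex = Bicomplex (bc_fst: complex) (bc_snd: complex)

instantiation bicomplex :: comm_ring_1
begin

definition "0 = Bicomplex 0 0"
definition "1 = Bicomplex 1 0"
definition "x + y = Bicomplex (bc_fst x + bc_fst y) (bc_snd x + bc_snd y)"
definition "- x = Bicomplex (- bc_fst x) (- bc_snd x)"
definition "x - y = Bicomplex (bc_fst x - bc_fst y) (bc_snd x - bc_snd y)"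
definition "x * y = Bicomplex (bc_fst x * bc_fst y - bc_snd x * bc_snd y)
                              (bc_fst x * bc_snd y + bc_snd x * bc_fst y)"

instance
  by intro_classes
    (auto simp: zero_bicomplex_def one_bicomplex_def plus_bicomplex_def uminus_bicomplex_def
      minus_bicomplex_def times_bicomplex_def algebra_simps)

end

definition bc_of_complex :: "complex \<Rightarrow> bicomplex" where
  "bc_of_complex z = Bicomplex z 0"

definition bc_i1 :: bicomplex where
  "bc_i1 = bc_of_complex \<i>"

definition bc_i2 :: bicomplex where
  "bc_i2 = Bicomplex 0 1"

definition bc_e1 :: bicomplex where
  "bc_e1 = bc_of_complex (1/2) * (1 + bc_i1 * bc_i2)"

definition bc_e2 :: bicomplex where
  "bc_e2 = bc_of_complex (1/2) * (1 - bc_i1 * bc_i2)"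

lemmas bc_defs = zero_bicomplex_def one_bicomplex_def plus_bicomplex_def uminus_bicomplex_def
  minus_bicomplex_def times_bicomplex_def bc_of_complex_def bc_i1_def bc_i2_def
  bc_e1_def bc_e2_def

lemma Bicomplex_eq: "Bicomplex z w = bc_of_complex z + bc_i2 * bc_of_complex w"
  by (simp add: bc_defs)

lemma bc_i1_squared: "bc_i1 * bc_i1 = - 1"
  and bc_i2_squared: "bc_i2 * bc_i2 = - 1"
  by (simp_all add: bc_defs)

lemma bc_idempotent_representation:
  "\<exists>!(a, b). \<xi> = bc_of_complex a * bc_e1 + bc_of_complex b * bc_e2"
proof -
  have eq: "\<xi> = bc_of_complex a * bc_e1 + bc_of_complex b * bc_e2 \<longleftrightarrow>
      a = bc_fst \<xi> - \<i> * bc_snd \<xi> \<and> b = bc_fst \<xi> + \<i> * bc_snd \<xi>" for a b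
    by (cases \<xi>) (auto simp: bc_defs complex_eq_iff field_simps)
  show ?thesis
    by (rule ex1I[of _ "(bc_fst \<xi> - \<i> * bc_snd \<xi>, bc_fst \<xi> + \<i> * bc_snd \<xi>)"]) (auto simp: eq)
qed

definition O2 :: "bicomplex set" where
  "O2 = {\<xi>. \<not> (\<exists>\<eta>. \<xi> * \<eta> = 1)}"

definition bc_nonsingular :: "bicomplex mat \<Rightarrow> bool" where
  "bc_nonsingular B \<longleftrightarrow> square_mat B \<and> det B \<notin> O2"

definition is_submatrix :: "'a mat \<Rightarrow> 'a mat \<Rightarrow> bool" (infix \<open>\<preceq>\<^sub>m\<close> 50) where
  "B \<preceq>\<^sub>m C \<longleftrightarrow>
    (\<exists>I J. I \<subseteq> {..<dim_row C} \<and> J \<subseteq> {..<dim_col C} \<and> B = submatrix C I J)"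

text \<open>\<open>nonsingular_chain r B'\<close>: there is a chain
  \<open>B\<^sub>1 \<preceq>\<^sub>m \<dots> \<preceq>\<^sub>m B\<^sub>r = B'\<close> of non-singular matrices, \<open>B\<^sub>i\<close> of size \<open>i \<times> i\<close>.\<close>

definition nonsingular_chain :: "nat \<Rightarrow> bicomplex mat \<Rightarrow> bool" where
  "nonsingular_chain r B' \<longleftrightarrow>
    (\<exists>B :: nat \<Rightarrow> bicomplex mat.
      (\<forall>i\<in>{1..r}. B i \<in> carrier_mat i i \<and> bc_nonsingular (B i)) \<and>
      (\<forall>i\<in>{1..<r}. B i \<preceq>\<^sub>m B (Suc i)) \<and>
      B r = B')"

definition is_bc_rank :: "bicomplex mat \<Rightarrow> nat \<Rightarrow> bool" where
  "is_bc_rank A r \<longleftrightarrow>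
    r \<ge> 1 \<and>
    (\<exists>B'. B' \<preceq>\<^sub>m A \<and> nonsingular_chain r B') \<and>
    (\<forall>t>r. \<forall>B'. B' \<preceq>\<^sub>m A \<and> B' \<in> carrier_mat t t \<longrightarrow> \<not> nonsingular_chain t B')"

lemma is_bc_rank_unique:
  assumes "is_bc_rank A r" "is_bc_rank A s"
  shows "r = s"
proof -
  have "\<not> x < y" if x: "is_bc_rank A x" and y: "is_bc_rank A y" for x y
  proof
    assume "x < y"
    from y obtain B' where B': "B' \<preceq>\<^sub>m A" "nonsingular_chain y B'" "y \<ge> 1"
      by (auto simp: is_bc_rank_def)
    then have "B' \<in> carrier_mat y y"
      by (auto simp: nonsingular_chain_def)
    with x B' \<open>x < y\<close> show False
      by (auto simp: is_bc_rank_def)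
  qed
  with assms show ?thesis
    by (meson linorder_neqE_nat)
qed

definition bc_rank :: "bicomplex mat \<Rightarrow> nat" where
  "bc_rank A = (if \<exists>r. is_bc_rank A r then THE r. is_bc_rank A r else 0)"

end

theory Submission
  imports Defs
begin

text \<open>The two coordinates of the idempotent representation are ring homomorphisms to the complex
  numbers, and an element is invertible iff both of its coordinates are nonzero. For a \<open>3 \<times> 3\<close>
  matrix, the vector \<open>w\<close> of cofactors of the first row is orthogonal to the second row. In each
  coordinate the second row has no zero entry, so if two entries of \<open>w\<close> vanish, then so does the
  third, and with it the determinant. Hence each coordinate of \<open>w\<close> has at most one zero entry, and
  one of the three positions is nonzero in both coordinates. The corresponding \<open>2 \<times> 2\<close>
  submatrix is non-singular, and its entries are units, which yields the chain.\<close>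

text \<open>The coefficient of \<open>bc_e1\<close>: since
  \<open>bc_i2 * bc_e1 = - bc_i1 * bc_e1\<close>, the unit \<open>bc_i2\<close> acts on this
  component as \<open>-\<i>\<close>. On the \<open>bc_e2\<close> component it acts as
  \<open>\<i>\<close>, which gives \<open>bc_proj2\<close>.\<close>

definition bc_proj1 :: "bicomplex \<Rightarrow> complex" where
  "bc_proj1 x = bc_fst x - \<i> * bc_snd x"

definition bc_proj2 :: "bicomplex \<Rightarrow> complex" where
  "bc_proj2 x = bc_fst x + \<i> * bc_snd x"

lemma bc_proj1_hom [simp]:
  "bc_proj1 0 = 0" "bc_proj1 1 = 1"
  "bc_proj1 (x + y) = bc_proj1 x + bc_proj1 y"
  "bc_proj1 (x - y) = bc_proj1 x - bc_proj1 y"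
  "bc_proj1 (- x) = - bc_proj1 x"
  "bc_proj1 (x * y) = bc_proj1 x * bc_proj1 y"
  by (simp_all add: bc_proj1_def bc_defs algebra_simps)

lemma bc_proj2_hom [simp]:
  "bc_proj2 0 = 0" "bc_proj2 1 = 1"
  "bc_proj2 (x + y) = bc_proj2 x + bc_proj2 y"
  "bc_proj2 (x - y) = bc_proj2 x - bc_proj2 y"
  "bc_proj2 (- x) = - bc_proj2 x"
  "bc_proj2 (x * y) = bc_proj2 x * bc_proj2 y"
  by (simp_all add: bc_proj2_def bc_defs algebra_simps)

lemma bc_eq_iff_proj: "x = y \<longleftrightarrow> bc_proj1 x = bc_proj1 y \<and> bc_proj2 x = bc_proj2 y"
  by (cases x; cases y) (auto simp: bc_proj1_def bc_proj2_def complex_eq_iff)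

lemma ex_bc_proj: "\<exists>x. bc_proj1 x = a \<and> bc_proj2 x = b"
  \<comment> \<open>The witness solves the linear system \<open>z - \<i> * w = a\<close>,
    \<open>z + \<i> * w = b\<close>.\<close>
  by (rule exI[of _ "Bicomplex ((a + b) / 2) (\<i> * (a - b) / 2)"])
    (simp add: bc_proj1_def bc_proj2_def complex_eq_iff field_simps)

text \<open>Homomorphisms send units to units; conversely, the inverses of the two coordinates are
  the coordinates of an inverse.\<close>

lemma not_in_O2_iff: "x \<notin> O2 \<longleftrightarrow> bc_proj1 x \<noteq> 0 \<and> bc_proj2 x \<noteq> 0"
proof
  assume "x \<notin> O2"
  then obtain y where "x * y = 1"
    by (auto simp: O2_def)
  then have "bc_proj1 x * bc_proj1 y = 1" "bc_proj2 x * bc_proj2 y = 1"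
    by (metis bc_proj1_hom(2,6), metis bc_proj2_hom(2,6))
  then show "bc_proj1 x \<noteq> 0 \<and> bc_proj2 x \<noteq> 0"
    by auto
next
  assume nz: "bc_proj1 x \<noteq> 0 \<and> bc_proj2 x \<noteq> 0"
  obtain y where "bc_proj1 y = inverse (bc_proj1 x)" "bc_proj2 y = inverse (bc_proj2 x)"
    using ex_bc_proj by blast
  with nz have "x * y = 1"
    by (simp add: bc_eq_iff_proj)
  then show "x \<notin> O2"
    by (auto simp: O2_def)
qed

text \<open>Here \<open>a\<close> and \<open>u\<close> stand for the first and second row. The signs
  of the cofactors are written out, so \<open>w\<close> holds the plain minors.\<close>

lemma orthogonal_two_nonzero:
  fixes w u a :: "nat \<Rightarrow> complex"
  assumes "u 0 * w 0 - u 1 * w 1 + u 2 * w 2 = 0"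
    and "a 0 * w 0 - a 1 * w 1 + a 2 * w 2 \<noteq> 0"
    and "u 0 \<noteq> 0" "u 1 \<noteq> 0" "u 2 \<noteq> 0"
  shows "w 0 \<noteq> 0 \<and> w 1 \<noteq> 0 \<or> w 0 \<noteq> 0 \<and> w 2 \<noteq> 0 \<or> w 1 \<noteq> 0 \<and> w 2 \<noteq> 0"
  using assms by (cases "w 0 = 0"; cases "w 1 = 0"; cases "w 2 = 0") auto

lemma ex_unit_in_orthogonal:
  fixes w u a :: "nat \<Rightarrow> bicomplex"
  assumes orth: "u 0 * w 0 - u 1 * w 1 + u 2 * w 2 = 0"
    and unit: "a 0 * w 0 - a 1 * w 1 + a 2 * w 2 \<notin> O2"
    and u: "\<And>j. j < 3 \<Longrightarrow> u j \<notin> O2"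
  shows "\<exists>j<3. w j \<notin> O2"
proof -
  have u': "bc_proj1 (u j) \<noteq> 0 \<and> bc_proj2 (u j) \<noteq> 0" if "j < 3" for j
    using u[OF that] by (simp add: not_in_O2_iff)
  have 1: "bc_proj1 (w 0) \<noteq> 0 \<and> bc_proj1 (w 1) \<noteq> 0 \<or> bc_proj1 (w 0) \<noteq> 0 \<and> bc_proj1 (w 2) \<noteq> 0
      \<or> bc_proj1 (w 1) \<noteq> 0 \<and> bc_proj1 (w 2) \<noteq> 0"
    using orthogonal_two_nonzero[of "bc_proj1 \<circ> u" "bc_proj1 \<circ> w" "bc_proj1 \<circ> a"]
      arg_cong[OF orth, of bc_proj1] unit u' by (simp add: not_in_O2_iff)
  have 2: "bc_proj2 (w 0) \<noteq> 0 \<and> bc_proj2 (w 1) \<noteq> 0 \<or> bc_proj2 (w 0) \<noteq> 0 \<and> bc_proj2 (w 2) \<noteq> 0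
      \<or> bc_proj2 (w 1) \<noteq> 0 \<and> bc_proj2 (w 2) \<noteq> 0"
    using orthogonal_two_nonzero[of "bc_proj2 \<circ> u" "bc_proj2 \<circ> w" "bc_proj2 \<circ> a"]
      arg_cong[OF orth, of bc_proj2] unit u' by (simp add: not_in_O2_iff)
  \<comment> \<open>Each coordinate rules out at most one position, so at least one of the three
    remains.\<close>
  have "w 0 \<notin> O2 \<or> w 1 \<notin> O2 \<or> w 2 \<notin> O2"
    using 1 2 by (auto simp: not_in_O2_iff)
  moreover have "(0::nat) < 3" "(1::nat) < 3" "(2::nat) < 3"
    by simp_all
  ultimately show ?thesis
    by blast
qed

text \<open>\<open>insert_index i\<close> is increasing and skips \<open>i\<close>, so exactly
  \<open>k\<close> elements of the set lie below \<open>insert_index i k\<close>; this count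
  determines what \<open>pick\<close> returns.\<close>

lemma pick_lessThan_delete:
  assumes "i < n" "k < n - 1"
  shows "pick ({..<n} - {i}) k = insert_index i k"
proof -
  have "{a \<in> {..<n} - {i}. a < insert_index i k} = insert_index i ` {..<k}"
  proof (intro equalityI subsetI)
    fix a assume a: "a \<in> {a \<in> {..<n} - {i}. a < insert_index i k}"
    then have "a = insert_index i (if a < i then a else a - 1)"
      by (auto simp: insert_index_def)
    moreover from a have "(if a < i then a else a - 1) < k"
      by (auto simp: insert_index_def split: if_splits)
    ultimately show "a \<in> insert_index i ` {..<k}"
      by blast
  qed (use assms in \<open>auto simp: insert_index_def\<close>)
  moreover have "inj_on (insert_index i) {..<k}"
    by (auto simp: inj_on_def insert_index_def split: if_splits)
  ultimately have card: "card {a \<in> {..<n} - {i}. a < insert_index i k} = k"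
    by (simp add: card_image)
  have "insert_index i k \<in> {..<n} - {i}"
    using assms by (auto simp: insert_index_def)
  from pick_card_in_set[OF this] show ?thesis
    by (simp only: card)
qed

text \<open>Links the minors of the Laplace expansion to the order used in chains.\<close>

lemma mat_delete_is_submatrix:
  assumes "i < dim_row A" "j < dim_col A"
  shows "mat_delete A i j \<preceq>\<^sub>m A"
proof -
  have card: "card {a. a < n \<and> a \<in> {..<n} - {k}} = n - 1" if "k < n" for k n :: nat
  proof -
    have "{a. a < n \<and> a \<in> {..<n} - {k}} = {..<n} - {k}"
      by auto
    with that show ?thesis
      by simp
  qed
  let ?I = "{..<dim_row A} - {i}" and ?J = "{..<dim_col A} - {j}"
  note card_I = card[OF assms(1)] and card_J = card[OF assms(2)]
  have "mat_delete A i j = submatrix A ?I ?J"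
  proof (rule eq_matI)
    fix k l
    assume "k < dim_row (submatrix A ?I ?J)" "l < dim_col (submatrix A ?I ?J)"
    then have kl: "k < dim_row A - 1" "l < dim_col A - 1"
      by (simp_all only: dim_submatrix card_I card_J)
    then have "submatrix A ?I ?J $$ (k, l) = A $$ (insert_index i k, insert_index j l)"
      by (simp only: submatrix_index card_I card_J pick_lessThan_delete assms)
    with kl show "mat_delete A i j $$ (k, l) = submatrix A ?I ?J $$ (k, l)"
      by (simp add: mat_delete_def insert_index_def)
  qed (simp_all only: dim_submatrix card_I card_J mat_delete_dim)
  then show ?thesis
    unfolding is_submatrix_def by (intro exI[of _ ?I] exI[of _ ?J]) auto
qed

lemma is_submatrix_refl: "A \<preceq>\<^sub>m A"
proof -
  have pick: "pick {..<n} k = k" if "k < n" for k n :: nat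
    \<comment> \<open>Cutting \<open>UNIV\<close> down to the indices below \<open>n\<close> keeps
      its first \<open>n\<close> picks.\<close>
    using pick_reduce_set[of k n UNIV] that by (simp add: pick_UNIV lessThan_def)
  have "A = submatrix A {..<dim_row A} {..<dim_col A}"
    by (rule eq_matI) (simp_all add: submatrix_def pick)
  then show ?thesis
    unfolding is_submatrix_def by blast
qed

lemma det_2x2:
  fixes A :: "'a :: comm_ring_1 mat"
  assumes "A \<in> carrier_mat 2 2"
  shows "det A = A $$ (0,0) * A $$ (1,1) - A $$ (0,1) * A $$ (1,0)"
  using assms
  by (subst laplace_expansion_row[of _ 2 0])
    (auto simp: numeral_2_eq_2 cofactor_def mat_delete_def det_single)

text \<open>Each size has its own reason: the empty minor has determinant 1, a minor of size 1 is an
  entry and hence a unit, and minors of size 2 fall under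
  \<open>ex_unit_in_orthogonal\<close>.\<close>

lemma ex_nonsingular_minor:
  assumes A: "A \<in> carrier_mat (Suc n) (Suc n)" and n: "Suc n \<le> 3"
    and nonsing: "bc_nonsingular A"
    and units: "\<And>i j. i < Suc n \<Longrightarrow> j < Suc n \<Longrightarrow> A $$ (i, j) \<notin> O2"
  shows "\<exists>j<Suc n. bc_nonsingular (mat_delete A 0 j)"
proof -
  have square: "square_mat (mat_delete A 0 j)" for j
    using A by simp
  consider "n = 0" | "n = 1" | "n = 2"
    using n by linarith
  then show ?thesis
  proof cases
    case 1
    then have "det (mat_delete A 0 0) = 1"
      using A by (intro det_dim_zero) (simp add: mat_delete_def)
    then have "bc_nonsingular (mat_delete A 0 0)"
      using square by (simp add: bc_nonsingular_def not_in_O2_iff)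
    then show ?thesis
      by blast
  next
    case 2
    then have "det (mat_delete A 0 0) = A $$ (1, 1)"
      using A by (subst det_single) (auto simp: mat_delete_def)
    then have "bc_nonsingular (mat_delete A 0 0)"
      using square units 2 by (simp add: bc_nonsingular_def)
    then show ?thesis
      by blast
  next
    case 3
    then have A3: "A \<in> carrier_mat 3 3"
      using A by (simp add: eval_nat_numeral)
    define w where "w j = det (mat_delete A 0 j)" for j
    have minor: "w j = mat_delete A 0 j $$ (0,0) * mat_delete A 0 j $$ (1,1)
        - mat_delete A 0 j $$ (0,1) * mat_delete A 0 j $$ (1,0)" for j
      unfolding w_def using A3 by (intro det_2x2) (auto simp: mat_delete_def)
    have w0: "w 0 = A $$ (1,1) * A $$ (2,2) - A $$ (1,2) * A $$ (2,1)"
      and w1: "w 1 = A $$ (1,0) * A $$ (2,2) - A $$ (1,2) * A $$ (2,0)"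
      and w2: "w 2 = A $$ (1,0) * A $$ (2,1) - A $$ (1,1) * A $$ (2,0)"
      using A3 unfolding minor by (simp_all add: mat_delete_def numeral_2_eq_2)
    have "det A = A $$ (0,0) * w 0 - A $$ (0,1) * w 1 + A $$ (0,2) * w 2"
      using laplace_expansion_row[OF A3, of 0]
      by (simp add: cofactor_def w_def eval_nat_numeral)
    then have "A $$ (0,0) * w 0 - A $$ (0,1) * w 1 + A $$ (0,2) * w 2 \<notin> O2"
      using nonsing by (simp add: bc_nonsingular_def)
    \<comment> \<open>This is the expansion of the determinant of \<open>A\<close> with its first
      row replaced by the second, a matrix with two equal rows.\<close>
    moreover have "A $$ (1,0) * w 0 - A $$ (1,1) * w 1 + A $$ (1,2) * w 2 = 0"
      unfolding w0 w1 w2 by (simp add: algebra_simps)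
    ultimately have "\<exists>j<3. w j \<notin> O2"
      using ex_unit_in_orthogonal[of "\<lambda>j. A $$ (1, j)" w "\<lambda>j. A $$ (0, j)"] units 3 by simp
    then show ?thesis
      using square 3 by (auto simp: bc_nonsingular_def w_def eval_nat_numeral)
  qed
qed

lemma nonsingular_chain_Suc:
  assumes chain: "nonsingular_chain n B" and "B \<preceq>\<^sub>m A"
    and "A \<in> carrier_mat (Suc n) (Suc n)" "bc_nonsingular A"
  shows "nonsingular_chain (Suc n) A"
proof -
  obtain C where "\<forall>i\<in>{1..n}. C i \<in> carrier_mat i i \<and> bc_nonsingular (C i)"
      "\<forall>i\<in>{1..<n}. C i \<preceq>\<^sub>m C (Suc i)" "C n = B"
    using chain by (auto simp: nonsingular_chain_def)
  with assms show ?thesis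
    unfolding nonsingular_chain_def
    by (intro exI[of _ "C(Suc n := A)"]) (auto simp: le_Suc_eq less_Suc_eq)
qed

text \<open>A minor inherits its entries from \<open>A\<close>, so they are again units and the
  induction can descend through one non-singular minor after another, down to the empty
  chain.\<close>

lemma nonsingular_chain_of_units:
  assumes "A \<in> carrier_mat n n" "n \<le> 3" "bc_nonsingular A"
    and "\<And>i j. i < n \<Longrightarrow> j < n \<Longrightarrow> A $$ (i, j) \<notin> O2"
  shows "nonsingular_chain n A"
  using assms
proof (induction n arbitrary: A)
  case 0
  then show ?case
    by (auto simp: nonsingular_chain_def)
next
  case (Suc n)
  obtain j where j: "j < Suc n" "bc_nonsingular (mat_delete A 0 j)"
    using ex_nonsingular_minor[OF Suc.prems] by blast
  have "mat_delete A 0 j \<in> carrier_mat n n"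
    using mat_delete_carrier[OF Suc.prems(1)] by simp
  moreover have "mat_delete A 0 j $$ (k, l) \<notin> O2" if "k < n" "l < n" for k l
    using that Suc.prems(1,4) by (simp add: mat_delete_def)
  ultimately have "nonsingular_chain n (mat_delete A 0 j)"
    using Suc.IH Suc.prems(2) j(2) by simp
  then show ?case
    using nonsingular_chain_Suc mat_delete_is_submatrix[of 0 A j] Suc.prems(1,3) j(1) by auto
qed

text \<open>Bounds the rank from above: a chain of length \<open>t\<close> ends in a matrix with
  \<open>t\<close> rows.\<close>

lemma is_submatrix_dim_row: "B \<preceq>\<^sub>m A \<Longrightarrow> dim_row B \<le> dim_row A"
proof -
  have "card {i. i < m \<and> i \<in> I} \<le> m" for m :: nat and I
    using card_mono[of "{..<m}" "{i. i < m \<and> i \<in> I}"] by auto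
  then show "B \<preceq>\<^sub>m A \<Longrightarrow> dim_row B \<le> dim_row A"
    by (auto simp: is_submatrix_def dim_submatrix)
qed

theorem theorem2p38:
  fixes A :: "bicomplex mat" and n :: nat
  assumes "n \<le> 3"
    and "A \<in> carrier_mat n n"
    and "bc_nonsingular A"
    and "\<And>i j. i < n \<Longrightarrow> j < n \<Longrightarrow> A $$ (i, j) \<notin> O2"
  shows "bc_rank A = n"
proof (cases "n = 0")
  case True
  \<comment> \<open>The rank of the empty matrix is the default value 0, because a rank
    \<open>r \<ge> 1\<close> would require a submatrix with at least one row.\<close>
  have "\<not> is_bc_rank A r" for r
  proof
    assume "is_bc_rank A r"
    then obtain B where "r \<ge> 1" "B \<preceq>\<^sub>m A" "nonsingular_chain r B"
      by (auto simp: is_bc_rank_def)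
    moreover from this have "B \<in> carrier_mat r r"
      by (auto simp: nonsingular_chain_def)
    ultimately show False
      using is_submatrix_dim_row[of B A] assms(2) True by auto
  qed
  with True show ?thesis
    by (simp add: bc_rank_def)
next
  case False
  have "is_bc_rank A n"
    unfolding is_bc_rank_def
  proof (intro conjI allI impI notI)
    show "n \<ge> 1"
      using False by simp
    show "\<exists>B'. B' \<preceq>\<^sub>m A \<and> nonsingular_chain n B'"
      using is_submatrix_refl nonsingular_chain_of_units[OF assms(2,1,3,4)] by blast
  next
    fix t B
    assume "n < t" "B \<preceq>\<^sub>m A \<and> B \<in> carrier_mat t t"
    then show False
      using is_submatrix_dim_row[of B A] assms(2) by auto
  qed
  then show ?thesis
    unfolding bc_rank_def using is_bc_rank_unique by auto
qed

end
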